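(* Let $n$ be known and let $p=p(n)$ satisfy $p \ge \frac{\ln n + \ln\ln n + \omega(1)}{n}$ (i.e., $pn - \ln n - \ln\ln n \to \infty$). Let $G$ be the random graph obtained by starting with the Erdős–Rényi random graph $G(n,p)$ on vertex set $[n]$, choosing the true order of the vertices uniformly at random among all $n!$ orders $\pi_1\prec\pi_2\prec\cdots\prec\pi_n$, and adding the edges $(\pi_i,\pi_{i+1})$ for $1\le i<n$. Then any algorithm which, given $G$ and only allowed to query edges of $G$ (a query of an edge reveals which endpoint precedes the other in the true order), determines the true order with probability at least $2/3$ (over the randomness of the algorithm and of $G$) must use $\Omega(n \log(pn))$ queries. *)

theory Defs
  imports "HOL-Probability.Probability" "HOL-Combinatorics.Multiset_Permutations"
begin

type_synonym graph = "nat set set"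

text \<open>Graphs on the vertex set \<open>{1..n}\<close> are sets of two-element edges; an order
  \<open>\<pi>\<^sub>1 \<prec> \<dots> \<prec> \<pi>\<^sub>n\<close> is the list of all vertices in increasing order.\<close>

definition all_edges :: "nat \<Rightarrow> graph" where
  "all_edges n = {e. e \<subseteq> {1..n} \<and> card e = 2}"

definition erdos_renyi :: "nat \<Rightarrow> real \<Rightarrow> graph pmf" where
  "erdos_renyi n p =
     map_pmf (\<lambda>f. {e \<in> all_edges n. f e})
       (Pi_pmf (all_edges n) False (\<lambda>_. bernoulli_pmf p))"

definition path_edges :: "nat list \<Rightarrow> graph" where
  "path_edges \<pi> = {{\<pi> ! i, \<pi> ! Suc i} | i. Suc i < length \<pi>}"

definition precedes :: "nat list \<Rightarrow> nat \<Rightarrow> nat \<Rightarrow> bool" where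
  "precedes \<pi> u v \<longleftrightarrow> (\<exists>i j. i < j \<and> j < length \<pi> \<and> \<pi> ! i = u \<and> \<pi> ! j = v)"

text \<open>The joint distribution of the graph given to the algorithm and the hidden true order.\<close>

definition sorting_instance :: "nat \<Rightarrow> real \<Rightarrow> (graph \<times> nat list) pmf" where
  "sorting_instance n p =
     bind_pmf (erdos_renyi n p) (\<lambda>E.
     bind_pmf (pmf_of_set (permutations_of_set {1..n})) (\<lambda>\<pi>.
     return_pmf (E \<union> path_edges \<pi>, \<pi>)))"

text \<open>A deterministic adaptive strategy is a decision tree: \<open>Query u v s t\<close> queries the edge
  \<open>{u, v}\<close> and continues with \<open>s\<close> if \<open>u\<close> precedes \<open>v\<close> and with \<open>t\<close> otherwise.\<close>

datatype strategy = Output "nat list" | Query nat nat strategy strategy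

fun result :: "nat list \<Rightarrow> strategy \<Rightarrow> nat list" where
  "result \<pi> (Output xs) = xs"
| "result \<pi> (Query u v s t) = result \<pi> (if precedes \<pi> u v then s else t)"

fun queries :: "nat list \<Rightarrow> strategy \<Rightarrow> nat set list" where
  "queries \<pi> (Output xs) = []"
| "queries \<pi> (Query u v s t) = {u, v} # queries \<pi> (if precedes \<pi> u v then s else t)"

text \<open>A randomized algorithm maps the given graph to a distribution on strategies. There are only
  countably many strategies, so discrete distributions lose no generality.\<close>

type_synonym algorithm = "graph \<Rightarrow> strategy pmf"

definition queries_only_edges :: "nat \<Rightarrow> real \<Rightarrow> algorithm \<Rightarrow> bool" where
  "queries_only_edges n p A \<longleftrightarrow>
     (\<forall>(G, \<pi>) \<in> set_pmf (sorting_instance n p). \<forall>s \<in> set_pmf (A G). set (queries \<pi> s) \<subseteq> G)"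

definition uses_at_most :: "nat \<Rightarrow> real \<Rightarrow> algorithm \<Rightarrow> nat \<Rightarrow> bool" where
  "uses_at_most n p A q \<longleftrightarrow>
     (\<forall>(G, \<pi>) \<in> set_pmf (sorting_instance n p). \<forall>s \<in> set_pmf (A G). length (queries \<pi> s) \<le> q)"

definition success_prob :: "nat \<Rightarrow> real \<Rightarrow> algorithm \<Rightarrow> real" where
  "success_prob n p A =
     measure_pmf.prob
       (bind_pmf (sorting_instance n p) (\<lambda>(G, \<pi>). map_pmf (\<lambda>s. (\<pi>, s)) (A G)))
       {(\<pi>, s). result \<pi> s = \<pi>}"

end

theory Submission imports Defs begin

text \<open>Write \<open>L\<close> for the law of \<open>G(n, p)\<close>. For a Hamiltonian path \<open>\<pi>\<close> of \<open>G\<close>, the probability that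
  adding \<open>\<pi>\<close> to \<open>G(n, p)\<close> gives \<open>G\<close> is \<open>L(G) / p\<^bsup>n-1\<^esup>\<close>, whatever \<open>\<pi>\<close> is. A strategy making at most
  \<open>q\<close> queries is right for at most \<open>2\<^sup>q\<close> orders. Summing over \<open>G\<close>, the success probability is at most
  \<open>2\<^sup>q / (n! p\<^bsup>n-1\<^esup>)\<close>, so \<open>q\<close> is at least \<open>log\<^sub>2 (n! p\<^bsup>n-1\<^esup>) - O(1)\<close>, which is of order \<open>n log (p n)\<close>
  because \<open>p n \<rightarrow> \<infinity>\<close>. There is no need to show that the number \<open>H(G)\<close> of
  Hamiltonian paths is typically large: planting a path multiplies \<open>L(G)\<close> by \<open>H(G) / (n! p\<^bsup>n-1\<^esup>)\<close>, and
  this factor \<open>H(G)\<close> cancels the \<open>1 / H(G)\<close> in the chance of guessing the path.\<close>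

text \<open>Each leaf is right for at most one order, and a binary tree of depth \<open>q\<close>
  has at most \<open>2 ^ q\<close> leaves. The depth is bounded only along orders in
  \<open>P\<close>, so \<open>P\<close> and \<open>q\<close> vary in the induction: the root's
  answer splits \<open>P\<close>, and each part goes to one subtree with one query fewer.\<close>

lemma card_correct_orders_le:
  assumes "finite P" "\<And>\<pi>. \<pi> \<in> P \<Longrightarrow> length (queries \<pi> s) \<le> q"
  shows "card {\<pi> \<in> P. result \<pi> s = \<pi>} \<le> 2 ^ q"
  using assms
proof (induction s arbitrary: P q)
  case (Output xs)
  have "card {\<pi> \<in> P. result \<pi> (Output xs) = \<pi>} \<le> card {xs}"
    by (rule card_mono) auto
  also have "\<dots> \<le> 2 ^ q" by simp
  finally show ?case .
next
  case (Query u v s t)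
  show ?case
  proof (cases q)
    case 0
    then have "P = {}"
      using Query.prems(2) by fastforce
    then show ?thesis by simp
  next
    case (Suc r)
    let ?P1 = "{\<pi> \<in> P. precedes \<pi> u v}" and ?P2 = "{\<pi> \<in> P. \<not> precedes \<pi> u v}"
    have 1: "card {\<pi> \<in> ?P1. result \<pi> s = \<pi>} \<le> 2 ^ r"
      by (rule Query.IH(1)) (use Query.prems Suc in fastforce)+
    have 2: "card {\<pi> \<in> ?P2. result \<pi> t = \<pi>} \<le> 2 ^ r"
      by (rule Query.IH(2)) (use Query.prems Suc in fastforce)+
    have "{\<pi> \<in> P. result \<pi> (Query u v s t) = \<pi>} =
        {\<pi> \<in> ?P1. result \<pi> s = \<pi>} \<union> {\<pi> \<in> ?P2. result \<pi> t = \<pi>}"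
      by auto
    then have "card {\<pi> \<in> P. result \<pi> (Query u v s t) = \<pi>} \<le>
        card {\<pi> \<in> ?P1. result \<pi> s = \<pi>} + card {\<pi> \<in> ?P2. result \<pi> t = \<pi>}"
      by (simp add: card_Un_le)
    with 1 2 Suc show ?thesis by simp
  qed
qed

text \<open>By linearity the sum is the expected number of orders in \<open>P\<close> for which the
  random strategy is right, and the count is bounded for every strategy in the support.\<close>

lemma sum_prob_correct_le:
  assumes "finite P" "\<And>\<pi> s. \<pi> \<in> P \<Longrightarrow> s \<in> set_pmf M \<Longrightarrow> length (queries \<pi> s) \<le> q"
  shows "(\<Sum>\<pi>\<in>P. measure_pmf.prob M {s. result \<pi> s = \<pi>}) \<le> 2 ^ q"
proof -
  have card: "(\<Sum>\<pi>\<in>P. indicat_real {s. result \<pi> s = \<pi>} s) = real (card {\<pi> \<in> P. result \<pi> s = \<pi>})" for s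
    using assms(1) by (simp add: indicator_def sum.If_cases Int_def)
  have "(\<Sum>\<pi>\<in>P. measure_pmf.prob M {s. result \<pi> s = \<pi>}) =
      measure_pmf.expectation M (\<lambda>s. \<Sum>\<pi>\<in>P. indicat_real {s. result \<pi> s = \<pi>} s)"
    by (subst Bochner_Integration.integral_sum)
      (auto intro!: integrable_real_indicator simp: measure_pmf.emeasure_finite less_top[symmetric])
  also have "\<dots> \<le> 2 ^ q"
  proof (rule measure_pmf.integral_le_const)
    show "integrable M (\<lambda>s. \<Sum>\<pi>\<in>P. indicat_real {s. result \<pi> s = \<pi>} s)"
      by (intro Bochner_Integration.integrable_sum)
        (auto intro!: integrable_real_indicator simp: measure_pmf.emeasure_finite less_top[symmetric])
    show "AE s in M. (\<Sum>\<pi>\<in>P. indicat_real {s. result \<pi> s = \<pi>} s) \<le> 2 ^ q"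
      unfolding card AE_measure_pmf_iff
    proof
      fix s assume "s \<in> set_pmf M"
      then have "card {\<pi> \<in> P. result \<pi> s = \<pi>} \<le> 2 ^ q"
        using assms by (intro card_correct_orders_le) auto
      then show "real (card {\<pi> \<in> P. result \<pi> s = \<pi>}) \<le> 2 ^ q"
        by (metis of_nat_le_iff of_nat_numeral of_nat_power)
    qed
  qed
  finally show ?thesis .
qed

lemma finite_all_edges: "finite (all_edges n)"
  by (rule finite_subset[of _ "Pow {1..n}"]) (auto simp: all_edges_def)

lemma pmf_random_subset:
  assumes "finite A" "G \<subseteq> A"
  shows "pmf (map_pmf (\<lambda>f. {e \<in> A. f e}) (Pi_pmf A False P)) G = (\<Prod>e\<in>A. pmf (P e) (e \<in> G))"
proof -
  let ?M = "Pi_pmf A False P"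
  have "pmf (map_pmf (\<lambda>f. {e \<in> A. f e}) ?M) G =
      measure_pmf.prob ?M ((\<lambda>f. {e \<in> A. f e}) -` {G})"
    by (simp add: pmf_map)
  \<comment> \<open>Any other function in the preimage is true somewhere outside \<open>A\<close>,
    where the product is almost surely at its default \<open>False\<close>.\<close>
  also have "\<dots> = measure_pmf.prob ?M {\<lambda>e. e \<in> G}"
  proof (rule measure_prob_cong_0)
    fix f assume f: "f \<in> (\<lambda>f. {e \<in> A. f e}) -` {G} - {\<lambda>e. e \<in> G}"
    then obtain e where "f e \<noteq> (e \<in> G)" by fastforce
    with f assms(2) have "e \<notin> A \<and> f e" by auto
    then show "pmf ?M f = 0"
      using assms(1) by (intro pmf_Pi_outside) auto
  qed (use assms(2) in auto)
  also have "\<dots> = (\<Prod>e\<in>A. pmf (P e) (e \<in> G))"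
    using assms by (subst measure_pmf_single, subst pmf_Pi') auto
  finally show ?thesis .
qed

text \<open>By independence of the edges, planting \<open>S\<close> turns the factor
  \<open>p\<close> of each edge of \<open>S\<close> into 1 and leaves the other factors alone. This
  gives equality when \<open>G\<close> contains \<open>S\<close>; otherwise the planted mass is
  0.\<close>

lemma pmf_planted_le:
  assumes p: "0 \<le> p" "p \<le> 1" and S: "S \<subseteq> all_edges n"
  shows "p ^ card S * pmf (map_pmf (\<lambda>E. E \<union> S) (erdos_renyi n p)) G \<le> pmf (erdos_renyi n p) G"
proof (cases "S \<subseteq> G \<and> G \<subseteq> all_edges n")
  case False
  then have "G \<notin> set_pmf (map_pmf (\<lambda>E. E \<union> S) (erdos_renyi n p))"
    using S by (auto simp: erdos_renyi_def)
  then have "pmf (map_pmf (\<lambda>E. E \<union> S) (erdos_renyi n p)) G = 0"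
    by (simp only: set_pmf_iff not_not)
  then show ?thesis by simp
next
  case True
  let ?A = "all_edges n"
  have fin: "finite ?A" by (rule finite_all_edges)
  \<comment> \<open>Planting acts on each coordinate separately, so the law is again a product; the
    conjunct \<open>e \<in> ?A\<close> keeps the default \<open>False\<close> outside.\<close>
  have "map_pmf (\<lambda>E. E \<union> S) (erdos_renyi n p) =
      map_pmf (\<lambda>f. {e \<in> ?A. f e})
        (map_pmf (\<lambda>f e. e \<in> ?A \<and> (f e \<or> e \<in> S)) (Pi_pmf ?A False (\<lambda>_. bernoulli_pmf p)))"
    unfolding erdos_renyi_def map_pmf_comp using S by (intro map_pmf_cong) auto
  also have "map_pmf (\<lambda>f e. e \<in> ?A \<and> (f e \<or> e \<in> S)) (Pi_pmf ?A False (\<lambda>_. bernoulli_pmf p)) =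
      Pi_pmf ?A False (\<lambda>e. map_pmf (\<lambda>b. b \<or> e \<in> S) (bernoulli_pmf p))"
    unfolding map_pmf_def using fin
    by (subst Pi_pmf_bind[where d' = False]) (auto intro!: bind_pmf_cong arg_cong[of _ _ return_pmf])
  finally have "pmf (map_pmf (\<lambda>E. E \<union> S) (erdos_renyi n p)) G =
      (\<Prod>e\<in>?A. pmf (map_pmf (\<lambda>b. b \<or> e \<in> S) (bernoulli_pmf p)) (e \<in> G))"
    using True by (simp add: pmf_random_subset fin)
  also have "\<dots> = (\<Prod>e\<in>?A. if e \<in> S then 1 else pmf (bernoulli_pmf p) (e \<in> G))"
    using True by (intro prod.cong) auto
  finally have planted: "pmf (map_pmf (\<lambda>E. E \<union> S) (erdos_renyi n p)) G = \<dots>" .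
  have "p ^ card S = (\<Prod>e\<in>?A. if e \<in> S then p else 1)"
    using S fin by (simp add: prod.If_cases Int_absorb1)
  then have "p ^ card S * pmf (map_pmf (\<lambda>E. E \<union> S) (erdos_renyi n p)) G =
      (\<Prod>e\<in>?A. (if e \<in> S then p else 1) * (if e \<in> S then 1 else pmf (bernoulli_pmf p) (e \<in> G)))"
    by (simp add: planted prod.distrib)
  also have "\<dots> = (\<Prod>e\<in>?A. pmf (bernoulli_pmf p) (e \<in> G))"
    using True p by (intro prod.cong) auto
  also have "\<dots> = pmf (erdos_renyi n p) G"
    unfolding erdos_renyi_def using True by (simp add: pmf_random_subset fin)
  finally show ?thesis by simp
qed

lemma path_edges_subset:
  assumes "\<pi> \<in> permutations_of_set {1..n}"
  shows "path_edges \<pi> \<subseteq> all_edges n"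
proof
  fix e assume "e \<in> path_edges \<pi>"
  then obtain i where i: "e = {\<pi> ! i, \<pi> ! Suc i}" "Suc i < length \<pi>"
    by (auto simp: path_edges_def)
  have "set \<pi> = {1..n}" "distinct \<pi>"
    using assms by (auto dest: permutations_of_setD)
  moreover from this i have "\<pi> ! i \<noteq> \<pi> ! Suc i"
    by (simp add: nth_eq_iff_index_eq)
  moreover have "\<pi> ! i \<in> set \<pi>" "\<pi> ! Suc i \<in> set \<pi>"
    using i by auto
  ultimately show "e \<in> all_edges n"
    by (simp add: all_edges_def i)
qed

text \<open>An upper bound suffices, since powers of \<open>p \<le> 1\<close> decrease in the
  exponent.\<close>

lemma card_path_edges_le: "card (path_edges \<pi>) \<le> length \<pi> - 1"
proof -
  have "path_edges \<pi> = (\<lambda>i. {\<pi> ! i, \<pi> ! Suc i}) ` {..<length \<pi> - 1}"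
    by (auto simp: path_edges_def)
  then show ?thesis
    using card_image_le[of "{..<length \<pi> - 1}"] by (metis card_lessThan finite_lessThan)
qed

lemma prob_bind_pmf_finite:
  assumes "finite B" "set_pmf M \<subseteq> B"
  shows "measure_pmf.prob (bind_pmf M f) X = (\<Sum>x\<in>B. pmf M x * measure_pmf.prob (f x) X)"
proof -
  have "measure_pmf.prob (bind_pmf M f) X = measure_pmf.expectation M (\<lambda>x. measure_pmf.prob (f x) X)"
    unfolding measure_pmf_bind
    by (subst measure_pmf.measure_bind[where N = "count_space UNIV"])
      (auto simp: measure_pmf_in_subprob_algebra)
  also have "\<dots> = (\<Sum>x\<in>B. pmf M x * measure_pmf.prob (f x) X)"
    using assms by (subst integral_measure_pmf[of B]) auto
  finally show ?thesis .
qed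

lemma success_prob_le:
  assumes p: "0 \<le> p" "p \<le> 1" and q: "uses_at_most n p A q"
  shows "success_prob n p A * (fact n * p ^ (n - 1)) \<le> 2 ^ q"
proof -
  let ?Perm = "permutations_of_set {1..n}" and ?Gr = "Pow (all_edges n)" and ?ER = "erdos_renyi n p"
  let ?planted = "\<lambda>\<pi>. map_pmf (\<lambda>E. E \<union> path_edges \<pi>) ?ER"
  let ?correct = "\<lambda>G \<pi>. measure_pmf.prob (A G) {s. result \<pi> s = \<pi>}"
  \<comment> \<open>The orders that can have produced \<open>G\<close>; the query bound is available
    exactly for these.\<close>
  define P where "P G = {\<pi> \<in> ?Perm. G \<in> set_pmf (?planted \<pi>)}" for G
  have finP: "finite (P G)" for G
    by (simp add: P_def)
  have fin: "finite ?Perm" "?Perm \<noteq> {}" "finite ?Gr"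
    by (auto simp: finite_all_edges)
  \<comment> \<open>Drawing the order first leaves, for each fixed order, a graph with a fixed
    planted path.\<close>
  have inst: "sorting_instance n p =
      bind_pmf (pmf_of_set ?Perm) (\<lambda>\<pi>. map_pmf (\<lambda>G. (G, \<pi>)) (?planted \<pi>))"
    unfolding sorting_instance_def
    by (subst bind_commute_pmf) (simp add: map_pmf_def bind_assoc_pmf bind_return_pmf)
  have supp: "(G, \<pi>) \<in> set_pmf (sorting_instance n p) \<longleftrightarrow> \<pi> \<in> P G" for G \<pi>
    unfolding inst P_def using fin by (auto simp: set_pmf_of_set)
  have set_planted: "set_pmf (?planted \<pi>) \<subseteq> ?Gr" if "\<pi> \<in> ?Perm" for \<pi>
    using path_edges_subset[OF that] by (auto simp: erdos_renyi_def)
  have "bind_pmf (sorting_instance n p) (\<lambda>(G, \<pi>). map_pmf (\<lambda>s. (\<pi>, s)) (A G)) =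
      bind_pmf (pmf_of_set ?Perm) (\<lambda>\<pi>. bind_pmf (?planted \<pi>) (\<lambda>G. map_pmf (\<lambda>s. (\<pi>, s)) (A G)))"
    unfolding inst by (simp add: bind_assoc_pmf bind_map_pmf)
  then have "success_prob n p A =
      (\<Sum>\<pi>\<in>?Perm. pmf (pmf_of_set ?Perm) \<pi> * (\<Sum>G\<in>?Gr. pmf (?planted \<pi>) G * ?correct G \<pi>))"
    unfolding success_prob_def
    using fin by (simp add: prob_bind_pmf_finite[of ?Perm] prob_bind_pmf_finite[OF fin(3) set_planted]
        vimage_def cong: sum.cong)
  also have "\<dots> = (\<Sum>\<pi>\<in>?Perm. (\<Sum>G\<in>?Gr. pmf (?planted \<pi>) G * ?correct G \<pi>)) / fact n"
    using fin by (simp add: sum_divide_distrib)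
  also have "(\<Sum>\<pi>\<in>?Perm. (\<Sum>G\<in>?Gr. pmf (?planted \<pi>) G * ?correct G \<pi>)) =
      (\<Sum>G\<in>?Gr. \<Sum>\<pi>\<in>?Perm. pmf (?planted \<pi>) G * ?correct G \<pi>)"
    by (rule sum.swap)
  also have "\<dots> = (\<Sum>G\<in>?Gr. \<Sum>\<pi>\<in>P G. pmf (?planted \<pi>) G * ?correct G \<pi>)"
    by (intro sum.cong[OF refl] sum.mono_neutral_right) (auto simp: P_def set_pmf_iff simp del: set_map_pmf)
  finally have "success_prob n p A * (fact n * p ^ (n - 1)) =
      (\<Sum>G\<in>?Gr. \<Sum>\<pi>\<in>P G. p ^ (n - 1) * pmf (?planted \<pi>) G * ?correct G \<pi>)"
    by (simp add: mult.assoc mult.commute[of _ "p ^ (n - Suc 0)"] flip: sum_distrib_left)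
  \<comment> \<open>The new weight does not depend on \<open>\<pi>\<close>, so it can be pulled out
    of the inner sum.\<close>
  also have "\<dots> \<le> (\<Sum>G\<in>?Gr. \<Sum>\<pi>\<in>P G. pmf ?ER G * ?correct G \<pi>)"
  proof (intro sum_mono mult_right_mono)
    fix G \<pi> assume "\<pi> \<in> P G"
    then have \<pi>: "\<pi> \<in> ?Perm" by (simp add: P_def)
    then have "card (path_edges \<pi>) \<le> n - 1"
      using card_path_edges_le[of \<pi>] by (simp add: length_finite_permutations_of_set)
    then have "p ^ (n - 1) * pmf (?planted \<pi>) G \<le> p ^ card (path_edges \<pi>) * pmf (?planted \<pi>) G"
      using p by (intro mult_right_mono power_decreasing) auto
    also have "\<dots> \<le> pmf ?ER G"
      using p path_edges_subset[OF \<pi>] by (rule pmf_planted_le)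
    finally show "p ^ (n - 1) * pmf (?planted \<pi>) G \<le> pmf ?ER G" .
  qed auto
  also have "\<dots> \<le> (\<Sum>G\<in>?Gr. pmf ?ER G * 2 ^ q)"
    unfolding sum_distrib_left[symmetric]
  proof (intro sum_mono mult_left_mono sum_prob_correct_le finP)
    fix G \<pi> s assume "\<pi> \<in> P G" "s \<in> set_pmf (A G)"
    then show "length (queries \<pi> s) \<le> q"
      using q supp unfolding uses_at_most_def by blast
  qed auto
  also have "\<dots> = 2 ^ q"
    unfolding sum_distrib_right[symmetric]
    by (subst sum_pmf_eq_1) (auto simp: erdos_renyi_def finite_all_edges)
  finally show ?thesis .
qed

text \<open>Crude Stirling bound: \<open>n ^ n / fact n\<close> is a single term of the series for
  \<open>exp n\<close>.\<close>

lemma ln_fact_ge: "real n * ln (real n) - real n \<le> ln (fact n)"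
proof (cases "n = 0")
  case False
  have "real n ^ n / fact n \<le> exp (real n)"
    using sum_le_suminf[OF sums_summable[OF exp_converges[of "real n"]], of "{n}"]
    by (simp add: exp_def divide_inverse mult.commute)
  then have "real n ^ n \<le> exp (real n) * fact n"
    by (simp add: field_simps)
  then have "ln (real n ^ n) \<le> ln (exp (real n) * fact n)"
    using False by (subst ln_le_cancel_iff) auto
  then show ?thesis
    using False by (simp add: ln_mult ln_realpow)
qed simp

theorem theorem2:
  fixes p :: "nat \<Rightarrow> real" and A :: "nat \<Rightarrow> algorithm" and q :: "nat \<Rightarrow> nat"
  assumes "\<And>n. 0 \<le> p n \<and> p n \<le> 1"
    and "filterlim (\<lambda>n. p n * real n - ln (real n) - ln (ln (real n))) at_top sequentially"
    and "\<And>n. queries_only_edges n (p n) (A n)"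
    and "\<And>n. success_prob n (p n) (A n) \<ge> 2 / 3"
    and "\<And>n. uses_at_most n (p n) (A n) (q n)"
  shows "(\<lambda>n. real (q n)) \<in> \<Omega>(\<lambda>n. real n * ln (p n * real n))"
proof (rule landau_omega.bigI[of "1 / 2"])
  \<comment> \<open>The threshold \<open>exp 4\<close> will give
    \<open>ln (p n * real n) \<ge> 4\<close>, so that a loss of \<open>2 * n\<close> is at most half
    of the main term. Taking \<open>n \<ge> exp 1\<close> makes \<open>ln n\<close> and
    \<open>ln (ln n)\<close> nonnegative.\<close>
  have "eventually (\<lambda>n. p n * real n - ln (real n) - ln (ln (real n)) \<ge> exp 4) sequentially"
    using assms(2) by (auto simp: filterlim_at_top)
  moreover have "eventually (\<lambda>n. real n \<ge> exp 1) sequentially"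
    by (rule eventually_compose_filterlim[OF eventually_ge_at_top filterlim_real_sequentially])
  ultimately show "eventually (\<lambda>n. norm (real (q n)) \<ge> 1 / 2 * norm (real n * ln (p n * real n))) sequentially"
  proof eventually_elim
    case (elim n)
    have n: "n > 0"
      using elim(2) exp_gt_zero[of "1::real"] by (cases n) (auto simp del: exp_gt_zero)
    then have "ln (real n) \<ge> 1"
      using elim(2) by (simp add: ln_ge_iff)
    with elim(1) have pn: "p n * real n \<ge> exp 4"
      using ln_ge_zero[of "ln (real n)"] by linarith
    then have pn_pos: "p n * real n > 0"
      using exp_gt_zero[of "4::real"] by linarith
    then have p: "p n > 0" "p n \<le> 1"
      using assms(1)[of n] n by (auto simp: zero_less_mult_iff)
    have ln_pn: "ln (p n * real n) \<ge> 4"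
      using pn pn_pos by (simp add: ln_ge_iff)
    \<comment> \<open>Exponent \<open>n\<close> in place of \<open>n - 1\<close> weakens the bound,
      but lets \<open>n * ln p\<close> and \<open>n * ln n\<close> combine into
      \<open>n * ln (p * n)\<close>.\<close>
    have "2 / 3 * (fact n * p n ^ n) \<le> success_prob n (p n) (A n) * (fact n * p n ^ (n - 1))"
      using p assms(4)[of n] by (intro mult_mono power_decreasing) auto
    also have "\<dots> \<le> 2 ^ q n"
      using p assms(5) by (intro success_prob_le) auto
    finally have "ln (2 / 3 * (fact n * p n ^ n)) \<le> ln (2 ^ q n)"
      using p by (subst ln_le_cancel_iff) auto
    then have "ln (2 / 3) + ln (fact n) + real n * ln (p n) \<le> real (q n) * ln 2"
      using p by (subst (asm) ln_mult, simp, simp, subst (asm) ln_mult) (auto simp: ln_realpow)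
    moreover have "real (q n) * ln 2 \<le> real (q n)"
      using ln_le_minus_one[of "2::real"] by (intro mult_left_le) auto
    moreover have "ln (2 / 3 :: real) \<ge> - 1"
      using ln_le_minus_one[of "3 / 2 :: real"] by (simp add: ln_div)
    moreover have "real n \<ge> 1" using n by simp
    moreover have "ln (p n * real n) = ln (p n) + ln (real n)"
      using p n by (simp add: ln_mult)
    \<comment> \<open>One \<open>n\<close> is lost in the factorial bound; the other covers the
      constant \<open>ln (2 / 3) \<ge> - 1\<close>.\<close>
    ultimately have "real n * ln (p n * real n) - 2 * real n \<le> real (q n)"
      using ln_fact_ge[of n] by (simp add: distrib_left)
    moreover have "real n * 4 \<le> real n * ln (p n * real n)"
      using ln_pn by (intro mult_left_mono) auto
    ultimately show ?case
      using ln_pn by (simp add: abs_mult)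
  qed
qed simp

end
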